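(* Let $q$ be an even positive integer and $n\ge1$. Then the function $f:\mathbb{Z}_q^n\to\mathbb{Z}_{2q}$ defined by $$f(x_1,\ldots,x_n)=\hat{x}_1^2+\cdots+\hat{x}_n^2-\hat{x}_1-\cdots-\hat{x}_n \pmod{2q}$$ is a $2q$-negabent function.
   Context: $\mathbb{Z}_m$ is the ring of integers modulo $m$. For $x\in\mathbb{Z}_q$, $\hat{x}\in\{0,\ldots,q-1\}$ is its least non-negative integer representative, and $\hat{\mathbf{x}}=(\hat{x}_1,\ldots,\hat{x}_n)$. Let $\xi$ be a primitive $q$-th root of unity and $\omega$ a primitive $2q$-th root of unity; $\langle\hat{\mathbf{x}},\hat{\mathbf{u}}\rangle=\sum_i\hat x_i\hat u_i$. The $2q$-nega-Hadamard transform of $f:\mathbb{Z}_q^n\to\mathbb{Z}_{2q}$ is $\mathcal{N}_f(\mathbf{u})=q^{-n/2}\sum_{\mathbf{x}\in\mathbb{Z}_q^n}\omega^{f(\mathbf{x})}\xi^{\langle\hat{\mathbf{x}},\hat{\mathbf{u}}\rangle}\omega^{\sum_i\hat{x}_i}$, and $f$ is $2q$-negabent if $|\mathcal{N}_f(\mathbf{u})|=1$ for all $\mathbf{u}\in\mathbb{Z}_q^n$. *)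

theory Defs
  imports Complex_Main "HOL-Library.FuncSet" "HOL-Number_Theory.Residues"
begin

definition primitive_root_of_unity :: "nat \<Rightarrow> complex \<Rightarrow> bool" where
  "primitive_root_of_unity m z \<longleftrightarrow> m > 0 \<and> z ^ m = 1 \<and> (\<forall>k. 0 < k \<and> k < m \<longrightarrow> z ^ k \<noteq> 1)"

text \<open>
  The elements of \<^term>\<open>residue_ring (int m)\<close> are the integers from 0 to m - 1, so an element of
  \<open>\<int>\<^sub>m\<close> is already its own least non-negative integer representative; the map
  from \<open>x\<close> to that representative is the inclusion into the integers and is not written.
\<close>
abbreviation Zmod :: "nat \<Rightarrow> int set" where
  "Zmod m \<equiv> carrier (residue_ring (int m))"

definition Zmod_vec :: "nat \<Rightarrow> nat \<Rightarrow> (nat \<Rightarrow> int) set" where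
  "Zmod_vec q n = {1..n} \<rightarrow>\<^sub>E Zmod q"

definition nega_Hadamard ::
  "complex \<Rightarrow> complex \<Rightarrow> nat \<Rightarrow> nat \<Rightarrow> ((nat \<Rightarrow> int) \<Rightarrow> int) \<Rightarrow> (nat \<Rightarrow> int) \<Rightarrow> complex" where
  "nega_Hadamard \<xi> \<omega> q n f u =
     complex_of_real (real q powr (- real n / 2)) *
     (\<Sum>x\<in>Zmod_vec q n.
        \<omega> powi (f x) * \<xi> powi (\<Sum>i=1..n. x i * u i) * \<omega> powi (\<Sum>i=1..n. x i))"

text \<open>
  \<open>\<xi>\<close> and \<open>\<omega>\<close> are intended to be primitive roots of unity of
  order \<open>q\<close> and \<open>2q\<close>; they need not be related by \<open>\<omega>\<^sup>2 = \<xi>\<close>.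
\<close>
definition negabent ::
  "complex \<Rightarrow> complex \<Rightarrow> nat \<Rightarrow> nat \<Rightarrow> ((nat \<Rightarrow> int) \<Rightarrow> int) \<Rightarrow> bool" where
  "negabent \<xi> \<omega> q n f \<longleftrightarrow>
     f \<in> Zmod_vec q n \<rightarrow> Zmod (2 * q) \<and>
     (\<forall>u\<in>Zmod_vec q n. cmod (nega_Hadamard \<xi> \<omega> q n f u) = 1)"

end

theory Submission
  imports Defs
begin

text \<open>
  Adding \<open>\<Sum> x\<^sub>i\<close> completes \<open>f\<close> to \<open>\<Sum> x\<^sub>i\<^sup>2\<close>, so the transform at \<open>u\<close> factors into the
  one-dimensional Gauss sums \<open>\<Sum>\<^sub>x \<omega>^(x\<^sup>2) \<xi>^(x u\<^sub>i)\<close>. As \<open>q\<close> is even, the summand has period \<open>q\<close>, so in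
  the squared modulus of the Gauss sum one may shift \<open>x = y + d\<close>; the inner sum over \<open>y\<close> is then
  \<open>\<Sum>\<^sub>y (\<omega>\<^sup>2)^(d y)\<close>, which vanishes unless \<open>d = 0\<close>. Hence each factor has modulus \<open>\<surd>q\<close>.
\<close>

text \<open>Raising the shift from \<open>i\<close> to \<open>i + 1\<close> trades the term
  \<open>h i\<close> for \<open>h (i + m)\<close>, which periodicity makes equal. Induction over the
  integers, upwards and downwards from 0, reaches every \<open>c\<close>; for \<open>m\<close> \<le>
  0 both sums are empty.\<close>

lemma sum_periodic_shift:
  fixes h :: "int \<Rightarrow> 'a::comm_monoid_add"
  assumes per: "\<And>x. h (x + m) = h x"
  shows "(\<Sum>x\<in>{0..<m}. h (x + c)) = (\<Sum>x\<in>{0..<m}. h x)"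
proof (cases "m > 0")
  case True
  have step: "(\<Sum>x\<in>{0..<m}. h (x + (i + 1))) = (\<Sum>x\<in>{0..<m}. h (x + i))" for i
  proof -
    have "(\<Sum>x\<in>{0..<m}. h (x + (i + 1))) = (\<Sum>x\<in>{1..<m+1}. h (x + i))"
      by (rule sum.reindex_bij_witness[of _ "\<lambda>x. x - 1" "\<lambda>x. x + 1"]) (auto simp: algebra_simps)
    also have "{1..<m+1} = insert m {1..<m}" using True by auto
    also have "(\<Sum>x\<in>insert m {1..<m}. h (x + i)) = h (i + m) + (\<Sum>x\<in>{1..<m}. h (x + i))"
      by (simp add: add.commute)
    also have "\<dots> = (\<Sum>x\<in>insert 0 {1..<m}. h (x + i))" by (simp add: per)
    also have "insert 0 {1..<m} = {0..<m}" using True by auto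
    finally show ?thesis .
  qed
  show ?thesis
  proof (induction c rule: int_induct[where k = 0])
    case (step2 i)
    then show ?case using step[of "i - 1"] by simp
  qed (simp_all add: step)
qed simp

lemma power_int_sum:
  fixes z :: "'a::field"
  assumes "z \<noteq> 0"
  shows "z powi (\<Sum>i\<in>A. f i) = (\<Prod>i\<in>A. z powi f i)"
  by (induction A rule: infinite_finite_induct) (simp_all add: assms power_int_add)

lemma power_int_mod:
  fixes z :: "'a::field"
  assumes "z \<noteq> 0" "z ^ m = 1"
  shows "z powi (k mod int m) = z powi k"
proof -
  have "z powi k = z powi (int m * (k div int m) + k mod int m)" by simp
  also have "\<dots> = (z powi int m) powi (k div int m) * z powi (k mod int m)"
    using assms(1) by (simp only: power_int_add power_int_mult simp_thms)
  finally show ?thesis using assms(2) by simp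
qed

lemma primitive_root_of_unity_norm:
  assumes "primitive_root_of_unity m z"
  shows "cmod z = 1"
  using assms power_eq_1_iff[of z m] by (auto simp: primitive_root_of_unity_def)

text \<open>Reducing the exponent modulo \<open>m\<close> leaves a natural number below
  \<open>m\<close>, and minimality of the order excludes every such number except 0.\<close>

lemma primitive_root_of_unity_powi_eq_1_iff:
  assumes "primitive_root_of_unity m z"
  shows "z powi k = 1 \<longleftrightarrow> int m dvd k"
proof -
  have m: "m > 0" "z ^ m = 1" and min: "\<And>j. 0 < j \<Longrightarrow> j < m \<Longrightarrow> z ^ j \<noteq> 1"
    using assms by (auto simp: primitive_root_of_unity_def)
  have "z \<noteq> 0" using primitive_root_of_unity_norm[OF assms] by auto
  define j where "j = nat (k mod int m)"
  have j: "int j = k mod int m" "j < m"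
    using m(1) by (simp_all add: j_def nat_less_iff)
  have "z powi k = z powi int j" by (simp add: j power_int_mod \<open>z \<noteq> 0\<close> m)
  hence "z powi k = 1 \<longleftrightarrow> j = 0" using min[of j] j(2) by (cases "j = 0") auto
  also have "\<dots> \<longleftrightarrow> int m dvd k" using j(1) by (auto simp: dvd_eq_mod_eq_0)
  finally show ?thesis .
qed

lemma sum_powi_root_of_unity:
  fixes z :: complex
  assumes "z ^ q = 1" "z \<noteq> 1" "q > 0"
  shows "(\<Sum>y\<in>{0..<int q}. z powi y) = 0"
proof -
  have "(\<Sum>y\<in>{0..<int q}. z powi y) = (\<Sum>k<q. z ^ k)"
    by (rule sum.reindex_bij_witness[of _ int nat]) (auto simp: power_int_def)
  also have "\<dots> = 0" using assms by (simp add: sum_gp_strict)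
  finally show ?thesis .
qed

lemma norm_quadratic_Gauss_sum:
  assumes q: "even q" "q > 0" and xi: "cmod \<xi> = 1" "\<xi> ^ q = 1"
    and om: "primitive_root_of_unity (2 * q) \<omega>"
  shows "cmod (\<Sum>x\<in>{0..<int q}. \<omega> powi x\<^sup>2 * \<xi> powi (x * u)) = sqrt (real q)"
proof -
  define g where "g x = \<omega> powi x\<^sup>2 * \<xi> powi (x * u)" for x
  let ?I = "{0..<int q}"
  note om1 = primitive_root_of_unity_powi_eq_1_iff[OF om]
  have nom: "cmod \<omega> = 1" using om by (rule primitive_root_of_unity_norm)
  have nz: "\<omega> \<noteq> 0" "\<xi> \<noteq> 0" using nom xi(1) by auto
  have per: "g (x + int q) = g x" for x
  proof -
    have "\<omega> powi (x + int q)\<^sup>2 = \<omega> powi x\<^sup>2 * \<omega> powi (2 * int q * x + (int q)\<^sup>2)"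
      by (simp add: power2_sum algebra_simps flip: power_int_add[OF disjI1[OF nz(1)]])
    \<comment> \<open>Evenness of \<open>q\<close> enters here: for \<open>q = 2 * b\<close> the
      expression equals \<open>2 * q * (x + b)\<close>.\<close>
    moreover have "int (2 * q) dvd 2 * int q * x + (int q)\<^sup>2"
      using q(1) by (auto simp: power2_eq_square elim!: evenE)
    moreover have "\<xi> powi ((x + int q) * u) = \<xi> powi (x * u) * (\<xi> powi int q) powi u"
      using nz by (simp only: distrib_right power_int_add power_int_mult simp_thms)
    ultimately show ?thesis using xi(2) om1 by (simp add: g_def)
  qed
  \<comment> \<open>The difference of the squares of \<open>d + y\<close> and \<open>y\<close> is
    linear in \<open>y\<close>, so the quadratic phase in \<open>y\<close> cancels. Conjugation
    inverts \<open>g y\<close>, which has modulus 1.\<close>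
  have corr: "g (d + y) * cnj (g y) = g d * (\<omega> powi (2 * d)) powi y" for d y
  proof -
    have "cmod (g y) = 1" by (simp add: g_def norm_mult norm_power_int nom xi(1))
    hence "g y * cnj (g y) = 1" by (simp flip: complex_norm_square)
    moreover have "g (d + y) = g d * (\<omega> powi (2 * d)) powi y * g y"
    proof -
      have "\<omega> powi (d + y)\<^sup>2 = \<omega> powi d\<^sup>2 * \<omega> powi (2 * d * y) * \<omega> powi y\<^sup>2"
        by (simp add: power2_sum algebra_simps flip: power_int_add[OF disjI1[OF nz(1)]])
      moreover have "\<xi> powi ((d + y) * u) = \<xi> powi (d * u) * \<xi> powi (y * u)"
        using nz by (simp only: distrib_right power_int_add simp_thms)
      ultimately show ?thesis by (simp add: g_def power_int_mult)
    qed
    ultimately show ?thesis by simp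
  qed
  have inner: "(\<Sum>y\<in>?I. (\<omega> powi (2 * d)) powi y) = (if d = 0 then of_nat q else 0)" if "d \<in> ?I" for d
  proof (cases "d = 0")
    case False
    \<comment> \<open>From 0 < \<open>d\<close> < \<open>q\<close> it follows that 0 <
      \<open>2 * d\<close> < \<open>2 * q\<close>.\<close>
    have "\<not> int (2 * q) dvd 2 * d"
      using False that by (auto dest!: zdvd_imp_le)
    hence "\<omega> powi (2 * d) \<noteq> 1" by (simp only: om1 not_False_eq_True)
    moreover have "(\<omega> powi (2 * d)) ^ q = \<omega> powi (2 * d * int q)"
      by (simp only: power_int_mult power_int_of_nat)
    hence "(\<omega> powi (2 * d)) ^ q = 1" by (simp add: om1)
    ultimately show ?thesis using False q(2) sum_powi_root_of_unity by simp
  qed simp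
  have "complex_of_real ((cmod (\<Sum>x\<in>?I. g x))\<^sup>2) = (\<Sum>x\<in>?I. g x) * cnj (\<Sum>y\<in>?I. g y)"
    by (rule complex_norm_square)
  also have "\<dots> = (\<Sum>y\<in>?I. (\<Sum>x\<in>?I. g x) * cnj (g y))"
    by (simp only: cnj_sum sum_distrib_left)
  \<comment> \<open>For each fixed \<open>y\<close> the inner sum is shifted by \<open>y\<close>, so
    \<open>d\<close> stands for the difference of the two original indices.\<close>
  also have "\<dots> = (\<Sum>y\<in>?I. (\<Sum>d\<in>?I. g (d + y)) * cnj (g y))"
    by (simp only: sum_periodic_shift[of g, OF per])
  also have "\<dots> = (\<Sum>y\<in>?I. \<Sum>d\<in>?I. g d * (\<omega> powi (2 * d)) powi y)"
    by (simp only: sum_distrib_right corr)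
  also have "\<dots> = (\<Sum>d\<in>?I. g d * (\<Sum>y\<in>?I. (\<omega> powi (2 * d)) powi y))"
    by (subst sum.swap) (simp only: sum_distrib_left)
  \<comment> \<open>Only \<open>d = 0\<close> survives, with weight \<open>g 0 = 1\<close>.\<close>
  also have "\<dots> = (\<Sum>d\<in>?I. if d = 0 then of_nat q else 0)"
    by (intro sum.cong refl) (simp add: inner, simp add: g_def)
  also have "\<dots> = complex_of_real (real q)" using q(2) by simp
  finally have "(cmod (\<Sum>x\<in>?I. g x))\<^sup>2 = real q" by (simp only: of_real_eq_iff)
  hence "cmod (\<Sum>x\<in>?I. g x) = sqrt (real q)"
    by (intro real_sqrt_unique[symmetric] norm_ge_zero)
  thus ?thesis by (simp only: g_def)
qed

theorem theorem7:
  fixes q n :: nat and \<xi> \<omega> :: complex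
  assumes "even q" and "q > 0" and "n \<ge> 1"
    and "primitive_root_of_unity q \<xi>"
    and "primitive_root_of_unity (2 * q) \<omega>"
  shows "negabent \<xi> \<omega> q n
           (\<lambda>x. ((\<Sum>i=1..n. (x i)\<^sup>2) - (\<Sum>i=1..n. x i)) mod int (2 * q))"
proof -
  let ?f = "\<lambda>x. ((\<Sum>i=1..n. (x i)\<^sup>2) - (\<Sum>i=1..n. x i)) mod int (2 * q)"
  let ?I = "{0..<int q}"
  have carrier: "Zmod m = {0..<int m}" for m
    by (auto simp: residue_ring_def)
  have nom: "cmod \<omega> = 1" "\<omega> ^ (2 * q) = 1" and nxi: "cmod \<xi> = 1" "\<xi> ^ q = 1"
    using assms(4,5)[THEN primitive_root_of_unity_norm] assms(4,5)
    by (simp_all add: primitive_root_of_unity_def)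
  have nz: "\<omega> \<noteq> 0" "\<xi> \<noteq> 0" using nom nxi by auto
  have "cmod (nega_Hadamard \<xi> \<omega> q n ?f u) = 1" for u
  proof -
    \<comment> \<open>The last factor cancels the linear part of \<open>?f\<close>; the reduction
      modulo \<open>2 * q\<close> is invisible to \<omega>, whose power of exponent
      \<open>2 * q\<close> is 1.\<close>
    have summand: "\<omega> powi ?f x * \<xi> powi (\<Sum>i=1..n. x i * u i) * \<omega> powi (\<Sum>i=1..n. x i)
        = (\<Prod>i=1..n. \<omega> powi (x i)\<^sup>2 * \<xi> powi (x i * u i))" for x
    proof -
      have "\<omega> powi ?f x * \<omega> powi (\<Sum>i=1..n. x i) = \<omega> powi (\<Sum>i=1..n. (x i)\<^sup>2)"
        unfolding power_int_mod[OF nz(1) nom(2)]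
        using nz by (simp flip: power_int_add)
      thus ?thesis using nz by (simp add: power_int_sum prod.distrib mult_ac)
    qed
    \<comment> \<open>Distributivity turns the sum over all vectors of a product over coordinates
      into a product of sums, one for each coordinate.\<close>
    have "cmod (nega_Hadamard \<xi> \<omega> q n ?f u) = real q powr (- real n / 2) *
        (\<Prod>i=1..n. cmod (\<Sum>x\<in>?I. \<omega> powi x\<^sup>2 * \<xi> powi (x * u i)))"
      using prod_sum_PiE[of "{1..n}" "\<lambda>_. ?I" "\<lambda>i x. \<omega> powi x\<^sup>2 * \<xi> powi (x * u i)"]
      unfolding nega_Hadamard_def summand Zmod_vec_def carrier
      by (simp add: norm_mult prod_norm)
    also have "\<dots> = real q powr (- real n / 2) * sqrt (real q) ^ n"
      by (simp add: norm_quadratic_Gauss_sum assms nxi)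
    \<comment> \<open>Written as a real power of \<open>q\<close>, the product of the
      \<open>n\<close> moduli cancels against the normalising factor.\<close>
    also have "sqrt (real q) ^ n = real q powr (real n / 2)"
    proof -
      have "sqrt (real q) ^ n = sqrt (real q) powr real n"
        using assms(2) by (simp add: powr_realpow)
      also have "\<dots> = (real q powr (1 / 2)) powr real n" by (simp only: powr_half_sqrt)
      finally show ?thesis by (simp only: powr_powr) simp
    qed
    finally show ?thesis using assms(2) by (simp flip: powr_add)
  qed
  thus ?thesis using assms(2) unfolding negabent_def carrier
    by (auto simp del: of_nat_mult)
qed

end
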